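(* RGA is consistent: there is no term $c$ such that both $\emptyset\vdash c$ and $\emptyset\vdash\neg c$ are derivable in RGA.
   Context: **Terms.** Raw terms are: variables $v_i$ ($i\in\mathbb N$, de Bruijn indices), and operator nodes, each consisting of an operator code, a binder count $k\in\mathbb N$ and a finite list of raw terms as arguments, in each of which the $k$ lowest indices are bound. RGA has ten operators: constants $\bot$, $\mathbf 0$, $\mathcal R$ (recursor), $\mathcal A$ (universal quantifier combinator); unary $\mathbf S$, $\neg$; unary $\lambda$ (binder count 1, the only binder); binary $=$, $\lor$, and application $\cdot$ (left associative). A term $t$ is well-formed, $\mathrm{wf}(t)$, iff it is built from variables and these ten operators at these arities and binder counts. "Term" means raw term; formulas are just terms. Closed means having no free variables. $\underline n=\mathbf S^n\mathbf 0$ is the numeral of $n$. $[v_i\mapsto s]t$ (also $[i\mapsto s]t$): capture-avoiding replacement of the free variable $v_i$ by $s$, other free variables unchanged. $b[t]$: $\beta$-instance, replacing index $0$ in $b$ by $t$ and decrementing all other free indices. $\uparrow t$: all free indices increased by one; $\uparrow\Gamma$ elementwise. $\mathrm{fv}$: set of free variables. Abbreviations: $t\neq u:=\neg(t=u)$; $t\,\mathsf N:=(t=t)$; $t\,\mathsf B:=(t\lor\neg t)$; $t\land u:=\neg(\neg t\lor\neg u)$. **Head steps** $t\triangleright t'$ (syntactic relation): $(\lambda b)\cdot t\triangleright b[t]$ if $\mathrm{wf}(t)$; $\mathcal R\cdot g\cdot h\cdot\mathbf 0\triangleright g$ if $\mathrm{wf}(h)$; $\mathcal R\cdot g\cdot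 h\cdot(\mathbf S\,\underline n)\triangleright h\cdot\underline n\cdot(\mathcal R\cdot g\cdot h\cdot\underline n)$ if $\mathrm{wf}(g)$; and $t\cdot u\triangleright t'\cdot u$ if $t\triangleright t'$. **Proofs.** A judgment $\Gamma\vdash c$ has a finite set $\Gamma$ of terms and a term $c$. A proof is a finite list of judgments each following from earlier entries by one rule below; a judgment is derivable if some proof contains it. Writing $\Gamma\vdash c$ as an assertion means derivability. Rules ($\Rightarrow$ from premises to conclusion, $\Leftrightarrow$ both directions): Structural: $\mathrm{wf}(c)\Rightarrow\Gamma,c\vdash c$; $\Gamma\vdash c\Rightarrow\Gamma,a\vdash c$; $\Gamma\vdash a$ and $\Gamma,a\vdash c\Rightarrow\Gamma\vdash c$; $\Gamma\vdash c$ with $\Gamma,c,s$ well-formed $\Rightarrow[v\mapsto s]\Gamma\vdash[v\mapsto s]c$. Truth values: $\Gamma\vdash a\Leftrightarrow\Gamma\vdash a=\underline 1$; $\Gamma\vdash\neg a\Leftrightarrow\Gamma\vdash a=\underline 0$. Negation: $\Gamma\vdash\neg a$, $\Gamma\vdash a$, $\mathrm{wf}(c)\Rightarrow\Gamma\vdash c$; $\Gamma\vdash a\Leftrightarrow\Gamma\vdash\neg\neg a$. Disjunction: $\Gamma\vdash a$, $\mathrm{wf}(b)\Rightarrow\Gamma\vdash a\lor b$; $\Gamma\vdash b$, $\mathrm{wf}(a)\Rightarrow\Gamma\vdash a\lor b$; $\Gamma\vdash\neg a$, $\Gamma\vdash\neg b\Rightarrow\Gamma\vdash\neg(a\lor b)$;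 $\Gamma\vdash a\lor b$, $\Gamma,a\vdash c$, $\Gamma,b\vdash c\Rightarrow\Gamma\vdash c$; $\Gamma\vdash\neg(a\lor b)\Rightarrow\Gamma\vdash\neg a$, and $\Rightarrow\Gamma\vdash\neg b$. Equality: $\Gamma\vdash a\,\mathsf N\Leftrightarrow\Gamma\vdash a=a$; $\Gamma\vdash a=b\Rightarrow\Gamma\vdash b=a$; $\Gamma\vdash a=b$, $\Gamma\vdash[v\mapsto a]p$, $\mathrm{wf}(p)\Rightarrow\Gamma\vdash[v\mapsto b]p$; $\Gamma\vdash a\ne b\Rightarrow\Gamma\vdash b\ne a$; $\Gamma\vdash a\,\mathsf N$, $\Gamma\vdash b\,\mathsf N\Rightarrow\Gamma\vdash(a=b)\,\mathsf B$; $\Gamma\vdash(a=b)\,\mathsf B\Rightarrow\Gamma\vdash(a\,\mathsf N)\land(b\,\mathsf N)$. Naturals: $\Gamma\vdash\mathbf 0\,\mathsf N$; $\Gamma\vdash a\,\mathsf N\Leftrightarrow\Gamma\vdash\mathbf S a\,\mathsf N$; $\Gamma\vdash a\,\mathsf N\Rightarrow\Gamma\vdash\mathbf S a\ne\mathbf 0$; $\Gamma\vdash a\ne b\Leftrightarrow\Gamma\vdash\mathbf S a\ne\mathbf S b$; $\Gamma\vdash\mathbf S a=\mathbf S b\Rightarrow\Gamma\vdash a=b$; $\Gamma\vdash\bot\,\mathsf N$, $\mathrm{wf}(p)\Rightarrow\Gamma\vdash p$. Induction: $\Gamma\vdash[i\mapsto\mathbf 0]c$; $v_i\,\mathsf N,c,\Gamma\vdash[i\mapsto\mathbf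 S v_i]c$; $\Gamma\vdash a\,\mathsf N$; $\mathrm{wf}(c)$; $i\notin\mathrm{fv}(\Gamma)$ $\Rightarrow\Gamma\vdash[i\mapsto a]c$. Conversion: if $c\triangleright c'$: $\Gamma\vdash c'\Leftrightarrow\Gamma\vdash c$; $\Gamma\vdash c'\,\mathsf N\Rightarrow\Gamma\vdash c=c'$. Recursor: $\Gamma\vdash m\,\mathsf N$, $\Gamma\vdash(h\cdot m\cdot(\mathcal R\cdot g\cdot h\cdot m))\,\mathsf N$, $\mathrm{wf}(g)\Rightarrow\Gamma\vdash\mathcal R\cdot g\cdot h\cdot(\mathbf S m)=h\cdot m\cdot(\mathcal R\cdot g\cdot h\cdot m)$. Quantifier: $v_0\,\mathsf N,\uparrow\Gamma\vdash\uparrow f\cdot v_0\Rightarrow\Gamma\vdash\mathcal A\cdot f$; $\Gamma\vdash\mathcal A\cdot f$, $\Gamma\vdash a\,\mathsf N\Rightarrow\Gamma\vdash f\cdot a$; $\Gamma\vdash\neg(f\cdot a)$, $\Gamma\vdash a\,\mathsf N\Rightarrow\Gamma\vdash\neg(\mathcal A\cdot f)$; $\Gamma\vdash\neg(\mathcal A\cdot f)$ and $v_0\,\mathsf N,\neg(\uparrow f\cdot v_0),\uparrow\Gamma\vdash\uparrow c\Rightarrow\Gamma\vdash c$. *)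

theory Defs
  imports Main "HOL-Library.FSet"
begin

(* Op f k ts: operator code f, binder count k, arguments ts; in each argument the k lowest
   indices are bound. Codes other than those assigned below, and wrong numbers of arguments or
   binders, are legal in raw terms but not in well-formed ones. *)
datatype trm = Var nat | Op nat nat "trm list"

abbreviation Bot :: trm where "Bot \<equiv> Op 0 0 []"
abbreviation Zero :: trm where "Zero \<equiv> Op 1 0 []"
abbreviation Rec :: trm where "Rec \<equiv> Op 2 0 []"
abbreviation AllC :: trm where "AllC \<equiv> Op 3 0 []"
abbreviation Succ :: "trm \<Rightarrow> trm" where "Succ a \<equiv> Op 4 0 [a]"
abbreviation Neg :: "trm \<Rightarrow> trm" where "Neg a \<equiv> Op 5 0 [a]"
abbreviation Lam :: "trm \<Rightarrow> trm" where "Lam b \<equiv> Op 6 1 [b]"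
abbreviation Eq :: "trm \<Rightarrow> trm \<Rightarrow> trm" where "Eq a b \<equiv> Op 7 0 [a, b]"
abbreviation Or :: "trm \<Rightarrow> trm \<Rightarrow> trm" where "Or a b \<equiv> Op 8 0 [a, b]"
abbreviation App :: "trm \<Rightarrow> trm \<Rightarrow> trm"  (infixl "\<cdot>" 200) where "f \<cdot> a \<equiv> Op 9 0 [f, a]"

abbreviation Neq :: "trm \<Rightarrow> trm \<Rightarrow> trm" where "Neq a b \<equiv> Neg (Eq a b)"
abbreviation isN :: "trm \<Rightarrow> trm" where "isN a \<equiv> Eq a a"
abbreviation isB :: "trm \<Rightarrow> trm" where "isB a \<equiv> Or a (Neg a)"
abbreviation And :: "trm \<Rightarrow> trm \<Rightarrow> trm" where "And a b \<equiv> Neg (Or (Neg a) (Neg b))"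

fun numl :: "nat \<Rightarrow> trm" where
  "numl 0 = Zero"
| "numl (Suc n) = Succ (numl n)"

inductive wf_trm :: "trm \<Rightarrow> bool" where
  "wf_trm (Var i)"
| "wf_trm Bot"
| "wf_trm Zero"
| "wf_trm Rec"
| "wf_trm AllC"
| "wf_trm a \<Longrightarrow> wf_trm (Succ a)"
| "wf_trm a \<Longrightarrow> wf_trm (Neg a)"
| "wf_trm b \<Longrightarrow> wf_trm (Lam b)"
| "wf_trm a \<Longrightarrow> wf_trm b \<Longrightarrow> wf_trm (Eq a b)"
| "wf_trm a \<Longrightarrow> wf_trm b \<Longrightarrow> wf_trm (Or a b)"
| "wf_trm a \<Longrightarrow> wf_trm b \<Longrightarrow> wf_trm (a \<cdot> b)"

fun fv :: "trm \<Rightarrow> nat set" where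
  "fv (Var i) = {i}"
| "fv (Op f k ts) = {i. \<exists>t \<in> set ts. i + k \<in> fv t}"

(* Adds n to every index that is at least d. *)
fun lift :: "nat \<Rightarrow> nat \<Rightarrow> trm \<Rightarrow> trm" where
  "lift n d (Var i) = Var (if i < d then i else i + n)"
| "lift n d (Op f k ts) = Op f k (map (lift n (d + k)) ts)"

abbreviation up :: "trm \<Rightarrow> trm" where "up t \<equiv> lift 1 0 t"

(* Replaces the free variable i by s; unlike in a beta-instance, no index is decremented. *)
fun subst_var :: "nat \<Rightarrow> trm \<Rightarrow> trm \<Rightarrow> trm" where
  "subst_var i s (Var j) = (if j = i then s else Var j)"
| "subst_var i s (Op f k ts) = Op f k (map (subst_var (i + k) (lift k 0 s)) ts)"

(* The instance of b below d binders; s lives outside these binders. *)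
fun inst_at :: "nat \<Rightarrow> trm \<Rightarrow> trm \<Rightarrow> trm" where
  "inst_at d s (Var j) = (if j < d then Var j else if j = d then lift d 0 s else Var (j - 1))"
| "inst_at d s (Op f k ts) = Op f k (map (inst_at (d + k) s) ts)"

abbreviation inst :: "trm \<Rightarrow> trm \<Rightarrow> trm" where "inst b t \<equiv> inst_at 0 t b"

inductive head_step :: "trm \<Rightarrow> trm \<Rightarrow> bool"  (infix "\<triangleright>" 50) where
  beta: "wf_trm t \<Longrightarrow> Lam b \<cdot> t \<triangleright> inst b t"
| rec_0: "wf_trm h \<Longrightarrow> Rec \<cdot> g \<cdot> h \<cdot> Zero \<triangleright> g"
| rec_S: "wf_trm g \<Longrightarrow> Rec \<cdot> g \<cdot> h \<cdot> Succ (numl n) \<triangleright> h \<cdot> numl n \<cdot> (Rec \<cdot> g \<cdot> h \<cdot> numl n)"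
| app_fun: "t \<triangleright> t' \<Longrightarrow> t \<cdot> u \<triangleright> t' \<cdot> u"

(* (\<Gamma>, c): the conclusion c under the finite set \<Gamma> of hypotheses. *)
type_synonym sequent = "trm fset \<times> trm"

abbreviation fv_ctx :: "trm fset \<Rightarrow> nat set" where "fv_ctx \<Gamma> \<equiv> (\<Union>a \<in> fset \<Gamma>. fv a)"

(* follows P J: the sequent J results from sequents in P by a single rule application.
   Rules stated as equivalences are split into two directions. *)
inductive follows :: "sequent set \<Rightarrow> sequent \<Rightarrow> bool" for P :: "sequent set" where
  hyp: "wf_trm c \<Longrightarrow> follows P (finsert c \<Gamma>, c)"
| weakening: "(\<Gamma>, c) \<in> P \<Longrightarrow> follows P (finsert a \<Gamma>, c)"
| cut: "(\<Gamma>, a) \<in> P \<Longrightarrow> (finsert a \<Gamma>, c) \<in> P \<Longrightarrow> follows P (\<Gamma>, c)"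
| subst_rule: "(\<Gamma>, c) \<in> P \<Longrightarrow> \<forall>a \<in> fset \<Gamma>. wf_trm a \<Longrightarrow> wf_trm c \<Longrightarrow> wf_trm s
    \<Longrightarrow> follows P (subst_var v s |`| \<Gamma>, subst_var v s c)"

| true_I: "(\<Gamma>, a) \<in> P \<Longrightarrow> follows P (\<Gamma>, Eq a (numl 1))"
| true_E: "(\<Gamma>, Eq a (numl 1)) \<in> P \<Longrightarrow> follows P (\<Gamma>, a)"
| false_I: "(\<Gamma>, Neg a) \<in> P \<Longrightarrow> follows P (\<Gamma>, Eq a (numl 0))"
| false_E: "(\<Gamma>, Eq a (numl 0)) \<in> P \<Longrightarrow> follows P (\<Gamma>, Neg a)"

| neg_E: "(\<Gamma>, Neg a) \<in> P \<Longrightarrow> (\<Gamma>, a) \<in> P \<Longrightarrow> wf_trm c \<Longrightarrow> follows P (\<Gamma>, c)"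
| neg_neg_I: "(\<Gamma>, a) \<in> P \<Longrightarrow> follows P (\<Gamma>, Neg (Neg a))"
| neg_neg_E: "(\<Gamma>, Neg (Neg a)) \<in> P \<Longrightarrow> follows P (\<Gamma>, a)"

| or_I1: "(\<Gamma>, a) \<in> P \<Longrightarrow> wf_trm b \<Longrightarrow> follows P (\<Gamma>, Or a b)"
| or_I2: "(\<Gamma>, b) \<in> P \<Longrightarrow> wf_trm a \<Longrightarrow> follows P (\<Gamma>, Or a b)"
| or_I3: "(\<Gamma>, Neg a) \<in> P \<Longrightarrow> (\<Gamma>, Neg b) \<in> P \<Longrightarrow> follows P (\<Gamma>, Neg (Or a b))"
| or_E1: "(\<Gamma>, Or a b) \<in> P \<Longrightarrow> (finsert a \<Gamma>, c) \<in> P \<Longrightarrow> (finsert b \<Gamma>, c) \<in> P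
    \<Longrightarrow> follows P (\<Gamma>, c)"
| or_E2: "(\<Gamma>, Neg (Or a b)) \<in> P \<Longrightarrow> follows P (\<Gamma>, Neg a)"
| or_E3: "(\<Gamma>, Neg (Or a b)) \<in> P \<Longrightarrow> follows P (\<Gamma>, Neg b)"

  (* The next two rules are trivial because isN abbreviates reflexive equality. *)
| isN_E: "(\<Gamma>, isN a) \<in> P \<Longrightarrow> follows P (\<Gamma>, Eq a a)"
| isN_I: "(\<Gamma>, Eq a a) \<in> P \<Longrightarrow> follows P (\<Gamma>, isN a)"
| eq_sym: "(\<Gamma>, Eq a b) \<in> P \<Longrightarrow> follows P (\<Gamma>, Eq b a)"
| eq_subst: "(\<Gamma>, Eq a b) \<in> P \<Longrightarrow> (\<Gamma>, subst_var v a p) \<in> P \<Longrightarrow> wf_trm p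
    \<Longrightarrow> follows P (\<Gamma>, subst_var v b p)"
| neq_sym: "(\<Gamma>, Neq a b) \<in> P \<Longrightarrow> follows P (\<Gamma>, Neq b a)"
| eq_isB_I: "(\<Gamma>, isN a) \<in> P \<Longrightarrow> (\<Gamma>, isN b) \<in> P \<Longrightarrow> follows P (\<Gamma>, isB (Eq a b))"
| eq_isB_E: "(\<Gamma>, isB (Eq a b)) \<in> P \<Longrightarrow> follows P (\<Gamma>, And (isN a) (isN b))"

| zero_isN: "follows P (\<Gamma>, isN Zero)"
| succ_isN_I: "(\<Gamma>, isN a) \<in> P \<Longrightarrow> follows P (\<Gamma>, isN (Succ a))"
| succ_isN_E: "(\<Gamma>, isN (Succ a)) \<in> P \<Longrightarrow> follows P (\<Gamma>, isN a)"
| succ_neq_zero: "(\<Gamma>, isN a) \<in> P \<Longrightarrow> follows P (\<Gamma>, Neq (Succ a) Zero)"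
| succ_neq_I: "(\<Gamma>, Neq a b) \<in> P \<Longrightarrow> follows P (\<Gamma>, Neq (Succ a) (Succ b))"
| succ_neq_E: "(\<Gamma>, Neq (Succ a) (Succ b)) \<in> P \<Longrightarrow> follows P (\<Gamma>, Neq a b)"
| succ_inj: "(\<Gamma>, Eq (Succ a) (Succ b)) \<in> P \<Longrightarrow> follows P (\<Gamma>, Eq a b)"
| bot_E: "(\<Gamma>, isN Bot) \<in> P \<Longrightarrow> wf_trm p \<Longrightarrow> follows P (\<Gamma>, p)"

| ind_rule: "(\<Gamma>, subst_var i Zero c) \<in> P
    \<Longrightarrow> (finsert (isN (Var i)) (finsert c \<Gamma>), subst_var i (Succ (Var i)) c) \<in> P
    \<Longrightarrow> (\<Gamma>, isN a) \<in> P \<Longrightarrow> wf_trm c \<Longrightarrow> i \<notin> fv_ctx \<Gamma>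
    \<Longrightarrow> follows P (\<Gamma>, subst_var i a c)"

| conv_I: "c \<triangleright> c' \<Longrightarrow> (\<Gamma>, c') \<in> P \<Longrightarrow> follows P (\<Gamma>, c)"
| conv_E: "c \<triangleright> c' \<Longrightarrow> (\<Gamma>, c) \<in> P \<Longrightarrow> follows P (\<Gamma>, c')"
| conv_eq: "c \<triangleright> c' \<Longrightarrow> (\<Gamma>, isN c') \<in> P \<Longrightarrow> follows P (\<Gamma>, Eq c c')"

| recursor: "(\<Gamma>, isN m) \<in> P \<Longrightarrow> (\<Gamma>, isN (h \<cdot> m \<cdot> (Rec \<cdot> g \<cdot> h \<cdot> m))) \<in> P \<Longrightarrow> wf_trm g
    \<Longrightarrow> follows P (\<Gamma>, Eq (Rec \<cdot> g \<cdot> h \<cdot> Succ m) (h \<cdot> m \<cdot> (Rec \<cdot> g \<cdot> h \<cdot> m)))"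

| all_I: "(finsert (isN (Var 0)) (up |`| \<Gamma>), up f \<cdot> Var 0) \<in> P \<Longrightarrow> follows P (\<Gamma>, AllC \<cdot> f)"
| all_E: "(\<Gamma>, AllC \<cdot> f) \<in> P \<Longrightarrow> (\<Gamma>, isN a) \<in> P \<Longrightarrow> follows P (\<Gamma>, f \<cdot> a)"
| not_all_I: "(\<Gamma>, Neg (f \<cdot> a)) \<in> P \<Longrightarrow> (\<Gamma>, isN a) \<in> P \<Longrightarrow> follows P (\<Gamma>, Neg (AllC \<cdot> f))"
| not_all_E: "(\<Gamma>, Neg (AllC \<cdot> f)) \<in> P
    \<Longrightarrow> (finsert (isN (Var 0)) (finsert (Neg (up f \<cdot> Var 0)) (up |`| \<Gamma>)), up c) \<in> P
    \<Longrightarrow> follows P (\<Gamma>, c)"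

definition is_proof :: "sequent list \<Rightarrow> bool" where
  "is_proof js \<longleftrightarrow> (\<forall>n < length js. follows (set (take n js)) (js ! n))"

definition derivable :: "trm fset \<Rightarrow> trm \<Rightarrow> bool"  (infix "\<turnstile>" 40) where
  "\<Gamma> \<turnstile> c \<longleftrightarrow> (\<exists>js. is_proof js \<and> (\<Gamma>, c) \<in> set js)"

end

theory Submission
  imports Defs
begin

text \<open>
  Truth is partial: a term is true if it evaluates to 1, false if it evaluates to 0, and many terms
  have no value at all. Evaluation is defined inductively on raw terms, with \<open>eval\<close> for big-step
  evaluation to a natural number and \<open>step\<close> for lazy head reduction in which the recursor first
  evaluates its numeric argument. The quantifier combinator gets an infinitary rule:
  \<open>AllC \<cdot> f\<close> is true if \<open>f\<close> is true at every numeral, and false if it is false at some numeral.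
  All rules use evaluation only positively, so the least relation exists.

  A sequent is read as: under every substitution of terms, possibly divergent ones, for the
  variables, the conclusion is true if all hypotheses are. The rules preserve this reading
  (\<open>follows_sound\<close>) because of three properties of evaluation.

    \<^item> Values are unique (\<open>step_eval_deterministic\<close>). This makes a contradictory context
      unsatisfiable, as the rule \<open>neg_E\<close> demands, and gives consistency.
    \<^item> Evaluation is stable under substitution (\<open>step_eval_sub\<close>). Hence the conversion rules,
      which mention open terms, are sound.
    \<^item> Replacing subterms by others with the same value preserves values (\<open>step_eval_similar\<close>).
      This is the substitution rule of equality, and it lets \<open>isN a\<close> stand for ``\<open>a\<close> may be
      replaced by a numeral'', which turns induction and quantifier elimination into statements
      about numerals.

  A derivable \<open>c\<close> from no hypotheses thus evaluates to 1, and a derivable \<open>Neg c\<close> forces \<open>c\<close> to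
  evaluate to 0.
\<close>

(* Truth is evaluation to 1; the numeral form keeps it recognisable to the simplifier. *)
declare One_nat_def [simp del]

section \<open>Parallel substitution\<close>

text \<open>The substitution that acts like \<open>\<sigma>\<close> below \<open>k\<close> further binders.\<close>

definition lifts :: "nat \<Rightarrow> (nat \<Rightarrow> trm) \<Rightarrow> nat \<Rightarrow> trm" where
  "lifts k \<sigma> i = (if i < k then Var i else lift k 0 (\<sigma> (i - k)))"

fun sub :: "(nat \<Rightarrow> trm) \<Rightarrow> trm \<Rightarrow> trm" where
  "sub \<sigma> (Var i) = \<sigma> i"
| "sub \<sigma> (Op f k ts) = Op f k (map (sub (lifts k \<sigma>)) ts)"

lemma sub_Var: "sub Var t = t"
proof (induction t)
  case (Op f k ts)
  have "lifts k Var = Var" by (auto simp: lifts_def)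
  then show ?case using Op by (simp add: map_idI)
qed simp

lemma lifts_0: "lifts 0 \<sigma> = \<sigma>"
proof -
  have id: "lift 0 d t = t" for d t
  proof (induction t arbitrary: d)
    case (Op f k ts)
    then show ?case by (simp add: map_idI)
  qed simp
  show ?thesis by (rule ext) (simp add: lifts_def id)
qed

lemma sub_cong_fv: "(\<And>i. i \<in> fv t \<Longrightarrow> \<sigma> i = \<tau> i) \<Longrightarrow> sub \<sigma> t = sub \<tau> t"
proof (induction t arbitrary: \<sigma> \<tau>)
  case (Op f k ts)
  have "sub (lifts k \<sigma>) t = sub (lifts k \<tau>) t" if "t \<in> set ts" for t
    using that
  proof (rule Op.IH)
    fix i assume "i \<in> fv t"
    show "lifts k \<sigma> i = lifts k \<tau> i"
    proof (cases "i < k")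
      case False
      then have "i - k \<in> fv (Op f k ts)" using \<open>i \<in> fv t\<close> that by auto
      then show ?thesis using Op.prems[of "i - k"] False by (simp only: lifts_def if_False)
    qed (simp add: lifts_def)
  qed
  then show ?case by simp
qed simp

lemma lift_as_sub: "lift n d t = sub (\<lambda>i. Var (if i < d then i else i + n)) t"
proof (induction t arbitrary: d)
  case (Op f k ts)
  have "lifts k (\<lambda>i. Var (if i < d then i else i + n))
      = (\<lambda>i. Var (if i < d + k then i else i + n))"
    by (auto simp: lifts_def fun_eq_iff)
  then show ?case using Op by simp
qed simp

text \<open>The composition law is proved in three stages, since going under a binder renames: the
  inner substitution is a renaming, then the outer one is, then both are arbitrary.\<close>

lemma sub_sub_renaming: "sub \<sigma> (sub (\<lambda>i. Var (\<rho> i)) t) = sub (\<lambda>i. \<sigma> (\<rho> i)) t"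
proof (induction t arbitrary: \<sigma> \<rho>)
  case (Op f k ts)
  define \<rho>' where "\<rho>' i = (if i < k then i else \<rho> (i - k) + k)" for i
  have "lifts k (\<lambda>i. Var (\<rho> i)) = (\<lambda>i. Var (\<rho>' i))"
    by (auto simp: lifts_def \<rho>'_def)
  moreover have "(\<lambda>i. lifts k \<sigma> (\<rho>' i)) = lifts k (\<lambda>i. \<sigma> (\<rho> i))"
    by (auto simp: lifts_def \<rho>'_def)
  ultimately show ?case using Op by simp
qed simp

lemma sub_lift: "sub \<sigma> (lift k 0 t) = sub (\<lambda>i. \<sigma> (i + k)) t"
  by (simp add: lift_as_sub sub_sub_renaming)

lemma renaming_sub: "sub (\<lambda>i. Var (\<rho> i)) (sub \<sigma> t) = sub (\<lambda>i. sub (\<lambda>i. Var (\<rho> i)) (\<sigma> i)) t"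
proof (induction t arbitrary: \<sigma> \<rho>)
  case (Op f k ts)
  define \<rho>' where "\<rho>' i = (if i < k then i else \<rho> (i - k) + k)" for i
  have *: "lifts k (\<lambda>i. Var (\<rho> i)) = (\<lambda>i. Var (\<rho>' i))"
    by (auto simp: lifts_def \<rho>'_def)
  have "(\<lambda>i. sub (\<lambda>i. Var (\<rho>' i)) (lifts k \<sigma> i))
      = lifts k (\<lambda>i. sub (\<lambda>i. Var (\<rho> i)) (\<sigma> i))"
    by (rule ext) (auto simp: lifts_def lift_as_sub sub_sub_renaming \<rho>'_def)
  then show ?case using Op * by simp
qed simp

lemma sub_sub: "sub \<sigma> (sub \<tau> t) = sub (\<lambda>i. sub \<sigma> (\<tau> i)) t"
proof (induction t arbitrary: \<sigma> \<tau>)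
  case (Op f k ts)
  have "(\<lambda>i. sub (lifts k \<sigma>) (lifts k \<tau> i)) = lifts k (\<lambda>i. sub \<sigma> (\<tau> i))"
  proof
    fix i
    show "sub (lifts k \<sigma>) (lifts k \<tau> i) = lifts k (\<lambda>i. sub \<sigma> (\<tau> i)) i"
    proof (cases "i < k")
      case False
      then have "sub (lifts k \<sigma>) (lifts k \<tau> i) = sub (\<lambda>i. lift k 0 (\<sigma> i)) (\<tau> (i - k))"
        by (simp add: lifts_def sub_lift)
      also have "\<dots> = lift k 0 (sub \<sigma> (\<tau> (i - k)))"
        by (simp add: lift_as_sub renaming_sub)
      finally show ?thesis using False by (simp add: lifts_def)
    qed (simp add: lifts_def)
  qed
  then show ?case using Op by simp
qed simp

lemma subst_var_as_sub: "subst_var i s t = sub (Var(i := s)) t"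
proof (induction t arbitrary: i s)
  case (Op f k ts)
  have "lifts k (Var(i := s)) = Var(i + k := lift k 0 s)"
    by (rule ext) (auto simp: lifts_def)
  then show ?case using Op by (simp del: fun_upd_apply)
qed simp

lemma inst_at_as_sub:
  "inst_at d s t = sub (\<lambda>j. if j < d then Var j else if j = d then lift d 0 s else Var (j - 1)) t"
proof (induction t arbitrary: d)
  case (Op f k ts)
  have "lift k 0 (lift d 0 s) = lift (d + k) 0 s"
    by (simp add: lift_as_sub sub_sub_renaming add.assoc)
  then have "lifts k (\<lambda>j. if j < d then Var j else if j = d then lift d 0 s else Var (j - 1))
      = (\<lambda>j. if j < d + k then Var j else if j = d + k then lift (d + k) 0 s else Var (j - 1))"
    by (intro ext) (auto simp: lifts_def)
  then show ?case using Op by simp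
qed simp

lemma inst_as_sub: "inst b t = sub (case_nat t Var) b"
proof -
  have "lift 0 0 t = t" by (simp add: lift_as_sub sub_Var)
  then have "(\<lambda>j. if j < 0 then Var j else if j = 0 then lift 0 0 t else Var (j - 1))
      = case_nat t Var"
    by (auto split: nat.splits)
  then show ?thesis by (simp add: inst_at_as_sub)
qed

lemma sub_subst_var: "sub \<sigma> (subst_var i s t) = sub (\<sigma>(i := sub \<sigma> s)) t"
proof -
  have "(\<lambda>j. sub \<sigma> ((Var(i := s)) j)) = \<sigma>(i := sub \<sigma> s)" by auto
  then show ?thesis by (simp add: subst_var_as_sub sub_sub)
qed

lemma sub_inst: "sub \<sigma> (inst b t) = inst (sub (lifts 1 \<sigma>) b) (sub \<sigma> t)"
proof -
  have "(\<lambda>i. sub \<sigma> (case_nat t Var i)) = (\<lambda>i. sub (case_nat (sub \<sigma> t) Var) (lifts 1 \<sigma> i))"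
  proof
    fix i
    show "sub \<sigma> (case_nat t Var i) = sub (case_nat (sub \<sigma> t) Var) (lifts 1 \<sigma> i)"
      by (cases i) (simp_all add: lifts_def sub_lift sub_Var flip: Suc_eq_plus1)
  qed
  then show ?thesis by (simp add: inst_as_sub sub_sub)
qed

lemma sub_up: "sub (case_nat s \<sigma>) (up t) = sub \<sigma> t"
  by (simp add: sub_lift flip: Suc_eq_plus1)

lemma sub_numl: "sub \<sigma> (numl n) = numl n"
  by (induction n) (auto simp: lifts_0)

section \<open>Evaluation\<close>

text \<open>
  The recursor steps as soon as its third argument has a value, whereas head steps wait for a
  literal numeral. Otherwise replacing that numeral by a term of equal value could block a
  reduction, and equality would not be substitutive in \<open>Rec \<cdot> g \<cdot> h \<cdot> m\<close>
  when this is applied to further arguments.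
\<close>

inductive step :: "trm \<Rightarrow> trm \<Rightarrow> bool" and eval :: "trm \<Rightarrow> nat \<Rightarrow> bool" where
  step_beta: "step (Lam b \<cdot> t) (inst b t)"
| step_rec_0: "eval m 0 \<Longrightarrow> step (Rec \<cdot> g \<cdot> h \<cdot> m) g"
| step_rec_S: "eval m (Suc k) \<Longrightarrow>
    step (Rec \<cdot> g \<cdot> h \<cdot> m) (h \<cdot> numl k \<cdot> (Rec \<cdot> g \<cdot> h \<cdot> numl k))"
| step_fun: "step t t' \<Longrightarrow> step (t \<cdot> u) (t' \<cdot> u)"
| eval_step: "step t t' \<Longrightarrow> eval t' n \<Longrightarrow> eval t n"
| eval_zero: "eval Zero 0"
| eval_succ: "eval a n \<Longrightarrow> eval (Succ a) (Suc n)"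
| eval_neg_0: "eval a 0 \<Longrightarrow> eval (Neg a) 1"
| eval_neg_1: "eval a 1 \<Longrightarrow> eval (Neg a) 0"
| eval_eq: "eval a n \<Longrightarrow> eval b n \<Longrightarrow> eval (Eq a b) 1"
| eval_neq: "eval a n \<Longrightarrow> eval b m \<Longrightarrow> n \<noteq> m \<Longrightarrow> eval (Eq a b) 0"
| eval_or_1: "eval a 1 \<Longrightarrow> eval (Or a b) 1"
| eval_or_2: "eval b 1 \<Longrightarrow> eval (Or a b) 1"
| eval_or_0: "eval a 0 \<Longrightarrow> eval b 0 \<Longrightarrow> eval (Or a b) 0"
| eval_all: "(\<And>n. eval (f \<cdot> numl n) 1) \<Longrightarrow> eval (AllC \<cdot> f) 1"
| eval_not_all: "eval (f \<cdot> numl n) 0 \<Longrightarrow> eval (AllC \<cdot> f) 0"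

inductive_cases step_VarE: "step (Var i) t'"
inductive_cases step_OpE: "step (Op f k ts) t'"
inductive_cases step_AppE: "step (t \<cdot> u) t'"

lemma no_step:
  "\<not> step (Var i) t'" "f \<noteq> 9 \<Longrightarrow> \<not> step (Op f k ts) t'"
  "\<not> step (AllC \<cdot> a) t'" "\<not> step (Rec \<cdot> a) t'" "\<not> step (Rec \<cdot> a \<cdot> b) t'"
proof -
  show 1: "\<not> step (Var i) t'" for i t' by (auto elim: step_VarE)
  show 2: "f \<noteq> 9 \<Longrightarrow> \<not> step (Op f k ts) t'" for f k ts t' by (auto elim: step_OpE)
  show "\<not> step (AllC \<cdot> a) t'" by (auto elim!: step_AppE simp: 2)
  show 3: "\<not> step (Rec \<cdot> a) t'" for a t' by (auto elim!: step_AppE simp: 2)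
  show "\<not> step (Rec \<cdot> a \<cdot> b) t'" by (auto elim!: step_AppE simp: 2)
qed

lemma step_Lam_iff: "step (Lam b \<cdot> t) t' \<longleftrightarrow> t' = inst b t"
  by (auto elim!: step_AppE intro: step_beta simp: no_step)

lemma eval_iffs:
  "eval Zero n \<longleftrightarrow> n = 0"
  "eval (Succ a) n \<longleftrightarrow> (\<exists>k. n = Suc k \<and> eval a k)"
  "eval (Neg a) n \<longleftrightarrow> (n = 1 \<and> eval a 0 \<or> n = 0 \<and> eval a 1)"
  "eval (Eq a b) n \<longleftrightarrow> (\<exists>j k. eval a j \<and> eval b k \<and> n = (if j = k then 1 else 0))"
  "eval (Or a b) n \<longleftrightarrow> (n = 1 \<and> (eval a 1 \<or> eval b 1) \<or> n = 0 \<and> eval a 0 \<and> eval b 0)"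
  "eval (AllC \<cdot> f) n \<longleftrightarrow>
    (n = 1 \<and> (\<forall>k. eval (f \<cdot> numl k) 1) \<or> n = 0 \<and> (\<exists>k. eval (f \<cdot> numl k) 0))"
proof -
  show "eval Zero n \<longleftrightarrow> n = 0"
    by (subst eval.simps) (simp add: no_step)
  show "eval (Succ a) n \<longleftrightarrow> (\<exists>k. n = Suc k \<and> eval a k)"
    by (subst eval.simps) (auto simp add: no_step)
  show "eval (Neg a) n \<longleftrightarrow> (n = 1 \<and> eval a 0 \<or> n = 0 \<and> eval a 1)"
    by (subst eval.simps) (auto simp add: no_step)
  show "eval (Eq a b) n \<longleftrightarrow> (\<exists>j k. eval a j \<and> eval b k \<and> n = (if j = k then 1 else 0))"
    by (subst eval.simps) (simp add: no_step, metis)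
  show "eval (Or a b) n \<longleftrightarrow> (n = 1 \<and> (eval a 1 \<or> eval b 1) \<or> n = 0 \<and> eval a 0 \<and> eval b 0)"
    by (subst eval.simps) (auto simp add: no_step)
  show "eval (AllC \<cdot> f) n \<longleftrightarrow>
    (n = 1 \<and> (\<forall>k. eval (f \<cdot> numl k) 1) \<or> n = 0 \<and> (\<exists>k. eval (f \<cdot> numl k) 0))"
    by (subst eval.simps) (auto simp add: no_step)
qed

lemma no_eval:
  "\<not> eval Bot n" "\<not> eval Rec n" "\<not> eval AllC n" "\<not> eval (Lam b) n" "\<not> eval (Var i) n"
  "\<not> eval (Rec \<cdot> a) n" "\<not> eval (Rec \<cdot> a \<cdot> b) n"
  by (subst eval.simps; simp add: no_step)+

lemma eval_numl: "eval (numl k) n \<longleftrightarrow> n = k"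
  by (induction k arbitrary: n) (auto simp: eval_iffs)

text \<open>
  The two relations are handled together, since a step of the recursor depends on a value.
  A redex has a different head shape from every term that evaluates without a step, and rules for
  the same head shape have premises that exclude each other, or agree in their conclusion, once
  the premises have unique values. A quantifier cannot be both true and false,
  because it would then be both at a single numeral.
\<close>

lemma step_eval_deterministic:
  "step t t' \<Longrightarrow> (\<forall>u. step t u \<longrightarrow> u = t')"
  "eval t n \<Longrightarrow> (\<forall>m. eval t m \<longrightarrow> m = n)"
proof (induction rule: step_eval.inducts)
  case (step_beta b t)
  then show ?case by (simp add: step_Lam_iff)
next
  case (step_rec_0 m g h)
  then show ?case by (fastforce elim!: step_AppE simp: no_step)
next
  case (step_rec_S m k g h)
  then show ?case by (fastforce elim!: step_AppE simp: no_step)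
next
  case (step_fun t t' u)
  then show ?case by (fastforce elim!: step_AppE simp: no_step)
next
  case (eval_step t t' n)
  show ?case
  proof (intro allI impI)
    fix m assume "eval t m"
    then show "m = n"
      using eval_step by cases (auto simp: no_step)
  qed
next
  case eval_zero
  then show ?case by (simp add: eval_iffs)
next
  case (eval_succ a n)
  then show ?case unfolding eval_iffs by blast
next
  case (eval_neg_0 a)
  then show ?case unfolding eval_iffs by metis
next
  case (eval_neg_1 a)
  then show ?case unfolding eval_iffs by metis
next
  case (eval_eq a n b)
  then show ?case unfolding eval_iffs by metis
next
  case (eval_neq a n b m)
  then show ?case unfolding eval_iffs by metis
next
  case (eval_or_1 a b)
  then show ?case unfolding eval_iffs by metis
next
  case (eval_or_2 b a)
  then show ?case unfolding eval_iffs by metis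
next
  case (eval_or_0 a b)
  then show ?case unfolding eval_iffs by metis
next
  case (eval_all f)
  then show ?case unfolding eval_iffs by metis
next
  case (eval_not_all f n)
  then show ?case unfolding eval_iffs by metis
qed

lemmas step_deterministic = step_eval_deterministic(1)[rule_format]
lemmas eval_deterministic = step_eval_deterministic(2)[rule_format]

lemma eval_along_step:
  assumes "step t t'"
  shows "eval t n \<longleftrightarrow> eval t' n"
proof
  assume "eval t n"
  then show "eval t' n"
    using assms
  proof cases
    case (eval_step t'')
    then show ?thesis using assms step_deterministic by metis
  qed (simp_all add: no_step)
qed (use assms in \<open>blast intro: eval_step\<close>)

lemma head_step_is_step: "c \<triangleright> c' \<Longrightarrow> step c c'"
  by (induction rule: head_step.induct)
    (auto intro: step_eval.intros simp: eval_numl eval_iffs)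

text \<open>No rule evaluates a variable, so every evaluation survives what is put in its place.\<close>

lemma step_eval_sub:
  "step t t' \<Longrightarrow> step (sub \<sigma> t) (sub \<sigma> t')"
  "eval t n \<Longrightarrow> eval (sub \<sigma> t) n"
proof (induction rule: step_eval.inducts)
  case (step_beta b t)
  then show ?case by (simp add: sub_inst lifts_0 step_Lam_iff)
qed (auto simp: lifts_0 sub_numl intro: step_eval.intros)

section \<open>Evaluation respects equality of values\<close>

text \<open>
  The congruence generated by equality of values. A term without value is related only to terms of
  the same shape with related arguments, and this is what makes the simulation below possible:
  only terms with a value, which are never functions, can change their shape.
\<close>

inductive similar :: "trm \<Rightarrow> trm \<Rightarrow> bool" (infix "\<approx>" 50) where
  same_value: "eval a n \<Longrightarrow> eval b n \<Longrightarrow> a \<approx> b"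
| similar_Var: "Var i \<approx> Var i"
| similar_Op: "list_all2 similar ts us \<Longrightarrow> Op f k ts \<approx> Op f k us"

lemma similar_refl: "t \<approx> t"
  by (induction t) (auto intro!: similar_Var similar_Op list.rel_refl_strong)

lemma similar_App: "a \<approx> b \<Longrightarrow> c \<approx> d \<Longrightarrow> a \<cdot> c \<approx> b \<cdot> d"
  by (auto intro: similar_Op)

lemma similar_OpE:
  assumes "Op f k ts \<approx> u"
  obtains n where "eval (Op f k ts) n" "eval u n"
  | us where "u = Op f k us" "list_all2 similar ts us"
  using assms by (auto elim: similar.cases)

lemma similar_unaryE:
  assumes "Op f k [a] \<approx> u"
  obtains n where "eval (Op f k [a]) n" "eval u n"
  | b where "u = Op f k [b]" "a \<approx> b"
  using assms by (rule similar_OpE) (auto simp: list_all2_Cons1)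

lemma similar_binaryE:
  assumes "Op f k [a, c] \<approx> u"
  obtains n where "eval (Op f k [a, c]) n" "eval u n"
  | b d where "u = Op f k [b, d]" "a \<approx> b" "c \<approx> d"
  using assms by (rule similar_OpE) (auto simp: list_all2_Cons1)

lemma similar_renaming: "t \<approx> u \<Longrightarrow> sub (\<lambda>i. Var (\<rho> i)) t \<approx> sub (\<lambda>i. Var (\<rho> i)) u"
proof (induction arbitrary: \<rho> rule: similar.induct)
  case (same_value a n b)
  then show ?case by (blast intro: similar.same_value step_eval_sub)
next
  case (similar_Op ts us f k)
  define \<rho>' where "\<rho>' i = (if i < k then i else \<rho> (i - k) + k)" for i
  have "lifts k (\<lambda>i. Var (\<rho> i)) = (\<lambda>i. Var (\<rho>' i))"
    by (auto simp: lifts_def \<rho>'_def)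
  with similar_Op show ?case
    by (auto simp: list.rel_map intro!: similar.similar_Op elim!: list.rel_mono_strong)
qed (simp add: similar.similar_Var)

text \<open>
  Terms related by a common value remain so by stability of evaluation; for the others the
  substitutions must be related under binders too, whence the preceding case of renamings.
\<close>

lemma similar_sub: "t \<approx> u \<Longrightarrow> (\<And>i. \<sigma> i \<approx> \<tau> i) \<Longrightarrow> sub \<sigma> t \<approx> sub \<tau> u"
proof (induction arbitrary: \<sigma> \<tau> rule: similar.induct)
  case (same_value a n b)
  then show ?case by (blast intro: similar.same_value step_eval_sub)
next
  case (similar_Op ts us f k)
  have "lifts k \<sigma> i \<approx> lifts k \<tau> i" for i
    using similar_Op.prems by (auto simp: lifts_def lift_as_sub similar_refl intro: similar_renaming)
  with similar_Op.IH show ?case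
    by (auto simp: list.rel_map intro!: similar.similar_Op elim!: list.rel_mono_strong)
qed simp

lemma similar_inst: "b \<approx> b' \<Longrightarrow> t \<approx> t' \<Longrightarrow> inst b t \<approx> inst b' t'"
  unfolding inst_as_sub by (erule similar_sub) (auto simp: similar_refl split: nat.split)

lemma steps_fun: "step\<^sup>*\<^sup>* t t' \<Longrightarrow> step\<^sup>*\<^sup>* (t \<cdot> u) (t' \<cdot> u)"
  by (induction rule: rtranclp_induct) (auto intro: step_fun rtranclp.rtrancl_into_rtrancl)

lemma eval_along_steps: "step\<^sup>*\<^sup>* t t' \<Longrightarrow> eval t n \<longleftrightarrow> eval t' n"
  by (induction rule: rtranclp_induct) (auto simp: eval_along_step)

lemma similar_LamE:
  assumes "Lam b \<approx> u"
  obtains b' where "u = Lam b'" "b \<approx> b'"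
  using assms by (rule similar_unaryE) (simp_all add: no_eval)

lemma similar_AllCE:
  assumes "AllC \<approx> u"
  obtains "u = AllC"
  using assms by (rule similar_OpE) (simp_all add: no_eval)

lemma similar_RecE:
  assumes "Rec \<cdot> g \<cdot> h \<approx> u"
  obtains g' h' where "u = Rec \<cdot> g' \<cdot> h'" "g \<approx> g'" "h \<approx> h'"
  using assms
proof (cases rule: similar_binaryE)
  case (2 r h')
  from 2(2) show ?thesis
  proof (cases rule: similar_binaryE)
    case (2 r' g')
    from 2(2) have "r' = Rec" by (rule similar_OpE) (simp_all add: no_eval)
    with 2 \<open>u = r \<cdot> h'\<close> \<open>h \<approx> h'\<close> show ?thesis using that by simp
  qed (simp add: no_eval)
qed (simp add: no_eval)

text \<open>
  The case of the simulation in which the two terms have a common value: the other term need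
  not move, since the reduct keeps the value.
\<close>

lemma similar_after_step:
  assumes "step t t'" "eval t n" "eval u n"
  shows "\<exists>u'. step\<^sup>*\<^sup>* u u' \<and> t' \<approx> u'"
proof (intro exI conjI)
  show "t' \<approx> u" using assms by (auto simp: eval_along_step intro: same_value)
qed simp

text \<open>
  A simulation argument. A function part such as \<open>Lam b\<close> or \<open>Rec \<cdot> g \<cdot> h\<close> has no value, so a term
  related to it has the same shape and takes the corresponding step; the numeric argument of
  the recursor evaluates to the same number on both sides by induction. Only related terms with
  a common value may differ in shape, which is why the other side takes any number of steps,
  possibly none.
\<close>

lemma step_eval_similar:
  "step t t' \<Longrightarrow> (\<forall>u. t \<approx> u \<longrightarrow> (\<exists>u'. step\<^sup>*\<^sup>* u u' \<and> t' \<approx> u'))"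
  "eval t n \<Longrightarrow> (\<forall>u. t \<approx> u \<longrightarrow> eval u n)"
proof (induction rule: step_eval.inducts)
  case (step_beta b t)
  show ?case
  proof (intro allI impI)
    fix u assume "Lam b \<cdot> t \<approx> u"
    then show "\<exists>u'. step\<^sup>*\<^sup>* u u' \<and> inst b t \<approx> u'"
    proof (cases rule: similar_binaryE)
      case (1 n)
      then show ?thesis by (rule similar_after_step[OF step_eval.step_beta])
    next
      case (2 c d)
      from 2(2) obtain b' where *: "c = Lam b'" "b \<approx> b'" by (rule similar_LamE)
      have "step u (inst b' d)" unfolding 2 * by (rule step_eval.step_beta)
      moreover have "inst b t \<approx> inst b' d" using * 2 by (intro similar_inst)
      ultimately show ?thesis by blast
    qed
  qed
next
  case (step_rec_0 m g h)
  show ?case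
  proof (intro allI impI)
    fix u assume "Rec \<cdot> g \<cdot> h \<cdot> m \<approx> u"
    then show "\<exists>u'. step\<^sup>*\<^sup>* u u' \<and> g \<approx> u'"
    proof (cases rule: similar_binaryE)
      case (1 n)
      then show ?thesis by (rule similar_after_step[OF step_eval.step_rec_0[OF step_rec_0.hyps]])
    next
      case (2 c d)
      from 2(2) obtain g' h' where *: "c = Rec \<cdot> g' \<cdot> h'" "g \<approx> g'" by (rule similar_RecE)
      have "eval d 0" using 2 step_rec_0 by simp
      then have "step u g'" unfolding 2 * by (rule step_eval.step_rec_0)
      then show ?thesis using * by blast
    qed
  qed
next
  case (step_rec_S m k g h)
  show ?case
  proof (intro allI impI)
    fix u assume "Rec \<cdot> g \<cdot> h \<cdot> m \<approx> u"
    then show "\<exists>u'. step\<^sup>*\<^sup>* u u' \<and> h \<cdot> numl k \<cdot> (Rec \<cdot> g \<cdot> h \<cdot> numl k) \<approx> u'"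
    proof (cases rule: similar_binaryE)
      case (1 n)
      then show ?thesis by (rule similar_after_step[OF step_eval.step_rec_S[OF step_rec_S.hyps]])
    next
      case (2 c d)
      from 2(2) obtain g' h' where *: "c = Rec \<cdot> g' \<cdot> h'" "g \<approx> g'" "h \<approx> h'"
        by (rule similar_RecE)
      have "eval d (Suc k)" using 2 step_rec_S by simp
      then have "step u (h' \<cdot> numl k \<cdot> (Rec \<cdot> g' \<cdot> h' \<cdot> numl k))"
        unfolding 2 * by (rule step_eval.step_rec_S)
      moreover have "h \<cdot> numl k \<cdot> (Rec \<cdot> g \<cdot> h \<cdot> numl k)
          \<approx> h' \<cdot> numl k \<cdot> (Rec \<cdot> g' \<cdot> h' \<cdot> numl k)"
        using * by (intro similar_App similar_refl)
      ultimately show ?thesis by blast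
    qed
  qed
next
  case (step_fun t t' v)
  show ?case
  proof (intro allI impI)
    fix u assume "t \<cdot> v \<approx> u"
    then show "\<exists>u'. step\<^sup>*\<^sup>* u u' \<and> t' \<cdot> v \<approx> u'"
    proof (cases rule: similar_binaryE)
      case (1 n)
      then show ?thesis by (rule similar_after_step[OF step_eval.step_fun[OF step_fun.hyps]])
    next
      case (2 c d)
      with step_fun obtain c' where "step\<^sup>*\<^sup>* c c'" "t' \<approx> c'" by blast
      then show ?thesis
        using 2 steps_fun similar_App by blast
    qed
  qed
next
  case (eval_step t t' n)
  then show ?case using eval_along_steps by blast
next
  case eval_zero
  show ?case by (auto simp: eval_iffs(1) elim: similar_OpE)
next
  case (eval_succ a n)
  show ?case
  proof (intro allI impI)
    fix u assume "Succ a \<approx> u"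
    then show "eval u (Suc n)"
    proof (cases rule: similar_unaryE)
      case (1 j)
      moreover have "eval (Succ a) (Suc n)"
        using eval_succ by (blast intro: step_eval.eval_succ)
      ultimately show ?thesis using eval_deterministic by metis
    qed (use eval_succ in \<open>blast intro: step_eval.eval_succ\<close>)
  qed
next
  case (eval_neg_0 a)
  show ?case
  proof (intro allI impI)
    fix u assume "Neg a \<approx> u"
    then show "eval u 1"
    proof (cases rule: similar_unaryE)
      case (1 j)
      moreover have "eval (Neg a) 1"
        using eval_neg_0 by (blast intro: step_eval.eval_neg_0)
      ultimately show ?thesis using eval_deterministic by metis
    qed (use eval_neg_0 in \<open>blast intro: step_eval.eval_neg_0\<close>)
  qed
next
  case (eval_neg_1 a)
  show ?case
  proof (intro allI impI)
    fix u assume "Neg a \<approx> u"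
    then show "eval u 0"
    proof (cases rule: similar_unaryE)
      case (1 j)
      moreover have "eval (Neg a) 0"
        using eval_neg_1 by (blast intro: step_eval.eval_neg_1)
      ultimately show ?thesis using eval_deterministic by metis
    qed (use eval_neg_1 in \<open>blast intro: step_eval.eval_neg_1\<close>)
  qed
next
  case (eval_eq a n b)
  show ?case
  proof (intro allI impI)
    fix u assume "Eq a b \<approx> u"
    then show "eval u 1"
    proof (cases rule: similar_binaryE)
      case (1 j)
      moreover have "eval (Eq a b) 1"
        using eval_eq by (blast intro: step_eval.eval_eq)
      ultimately show ?thesis using eval_deterministic by metis
    qed (use eval_eq in \<open>blast intro: step_eval.eval_eq\<close>)
  qed
next
  case (eval_neq a n b m)
  show ?case
  proof (intro allI impI)
    fix u assume "Eq a b \<approx> u"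
    then show "eval u 0"
    proof (cases rule: similar_binaryE)
      case (1 j)
      moreover have "eval (Eq a b) 0"
        using eval_neq by (blast intro: step_eval.eval_neq)
      ultimately show ?thesis using eval_deterministic by metis
    qed (use eval_neq in \<open>blast intro: step_eval.eval_neq\<close>)
  qed
next
  case (eval_or_1 a b)
  show ?case
  proof (intro allI impI)
    fix u assume "Or a b \<approx> u"
    then show "eval u 1"
    proof (cases rule: similar_binaryE)
      case (1 j)
      moreover have "eval (Or a b) 1"
        using eval_or_1 by (blast intro: step_eval.eval_or_1)
      ultimately show ?thesis using eval_deterministic by metis
    qed (use eval_or_1 in \<open>blast intro: step_eval.eval_or_1\<close>)
  qed
next
  case (eval_or_2 b a)
  show ?case
  proof (intro allI impI)
    fix u assume "Or a b \<approx> u"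
    then show "eval u 1"
    proof (cases rule: similar_binaryE)
      case (1 j)
      moreover have "eval (Or a b) 1"
        using eval_or_2 by (blast intro: step_eval.eval_or_2)
      ultimately show ?thesis using eval_deterministic by metis
    qed (use eval_or_2 in \<open>blast intro: step_eval.eval_or_2\<close>)
  qed
next
  case (eval_or_0 a b)
  show ?case
  proof (intro allI impI)
    fix u assume "Or a b \<approx> u"
    then show "eval u 0"
    proof (cases rule: similar_binaryE)
      case (1 j)
      moreover have "eval (Or a b) 0"
        using eval_or_0 by (blast intro: step_eval.eval_or_0)
      ultimately show ?thesis using eval_deterministic by metis
    qed (use eval_or_0 in \<open>blast intro: step_eval.eval_or_0\<close>)
  qed
next
  case (eval_all f)
  show ?case
  proof (intro allI impI)
    fix u assume "AllC \<cdot> f \<approx> u"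
    then show "eval u 1"
    proof (cases rule: similar_binaryE)
      case (1 j)
      moreover have "eval (AllC \<cdot> f) 1"
        using eval_all by (blast intro: step_eval.eval_all)
      ultimately show ?thesis using eval_deterministic by metis
    next
      case (2 c g)
      then have "c = AllC" by (blast elim: similar_AllCE)
      then show ?thesis
        unfolding 2 using 2 eval_all.IH
        by (auto intro!: step_eval.eval_all similar_App similar_refl)
    qed
  qed
next
  case (eval_not_all f n)
  show ?case
  proof (intro allI impI)
    fix u assume "AllC \<cdot> f \<approx> u"
    then show "eval u 0"
    proof (cases rule: similar_binaryE)
      case (1 j)
      moreover have "eval (AllC \<cdot> f) 0"
        using eval_not_all by (blast intro: step_eval.eval_not_all)
      ultimately show ?thesis using eval_deterministic by metis
    next
      case (2 c g)
      then have "c = AllC" by (blast elim: similar_AllCE)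
      then show ?thesis
        unfolding 2 using 2 eval_not_all.IH similar_App[OF _ similar_refl]
        by (blast intro: step_eval.eval_not_all)
    qed
  qed
qed

lemmas eval_similar = step_eval_similar(2)[rule_format]

lemma eval_sub_upd:
  assumes "eval a n" "eval b n" "eval (sub (\<sigma>(v := a)) p) m"
  shows "eval (sub (\<sigma>(v := b)) p) m"
proof -
  have "sub (\<sigma>(v := a)) p \<approx> sub (\<sigma>(v := b)) p"
    using assms by (intro similar_sub) (auto simp: similar_refl intro: same_value)
  then show ?thesis using assms(3) eval_similar by blast
qed

lemma eval_App_arg:
  assumes "eval a n" "eval b n" "eval (f \<cdot> a) m"
  shows "eval (f \<cdot> b) m"
proof (rule eval_similar[OF assms(3)])
  show "f \<cdot> a \<approx> f \<cdot> b"
    using assms(1,2) by (intro similar_App similar_refl same_value)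
qed

section \<open>Soundness\<close>

text \<open>
  The substitution ranges over all terms, since the substitution rule allows variables to be
  replaced by terms without value; hypotheses \<open>isN (Var i)\<close> restrict a variable to terms with one.
\<close>

definition models :: "(nat \<Rightarrow> trm) \<Rightarrow> trm fset \<Rightarrow> bool" where
  "models \<sigma> \<Gamma> \<longleftrightarrow> (\<forall>a \<in> fset \<Gamma>. eval (sub \<sigma> a) 1)"

lemma models_finsert: "models \<sigma> (finsert a \<Gamma>) \<longleftrightarrow> eval (sub \<sigma> a) 1 \<and> models \<sigma> \<Gamma>"
  by (simp add: models_def)

lemma models_subst_var: "models \<sigma> (subst_var v s |`| \<Gamma>) \<longleftrightarrow> models (\<sigma>(v := sub \<sigma> s)) \<Gamma>"
  unfolding models_def sub_subst_var[symmetric] by auto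

lemma models_up: "models (case_nat s \<sigma>) (up |`| \<Gamma>) \<longleftrightarrow> models \<sigma> \<Gamma>"
  by (simp add: models_def sub_up)

lemma models_fun_upd: "i \<notin> fv_ctx \<Gamma> \<Longrightarrow> models (\<sigma>(i := s)) \<Gamma> \<longleftrightarrow> models \<sigma> \<Gamma>"
proof -
  assume i: "i \<notin> fv_ctx \<Gamma>"
  have "sub (\<sigma>(i := s)) a = sub \<sigma> a" if "a |\<in>| \<Gamma>" for a
    using i that by (intro sub_cong_fv) auto
  then show ?thesis by (simp add: models_def)
qed

lemma eval_isN_iff: "eval (isN a) m \<longleftrightarrow> m = 1 \<and> (\<exists>n. eval a n)"
proof
  assume "eval (isN a) m"
  then obtain j k where jk: "eval a j" "eval a k" "m = (if j = k then 1 else 0)"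
    unfolding eval_iffs(4) by blast
  then have "j = k" by (intro eval_deterministic)
  with jk show "m = 1 \<and> (\<exists>n. eval a n)" by auto
next
  assume "m = 1 \<and> (\<exists>n. eval a n)"
  then show "eval (isN a) m" by (blast intro: step_eval.eval_eq)
qed

lemma eval_Eq_1_iff: "eval (Eq a b) 1 \<longleftrightarrow> (\<exists>n. eval a n \<and> eval b n)"
  unfolding eval_iffs(4) by (metis zero_neq_one)

lemma eval_Eq_0_iff: "eval (Eq a b) 0 \<longleftrightarrow> (\<exists>n m. eval a n \<and> eval b m \<and> n \<noteq> m)"
  unfolding eval_iffs(4) by (metis zero_neq_one)

lemma eval_connective_iffs:
  "eval (Neg a) 1 \<longleftrightarrow> eval a 0" "eval (Neg a) 0 \<longleftrightarrow> eval a 1"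
  "eval (Or a b) 1 \<longleftrightarrow> eval a 1 \<or> eval b 1" "eval (Or a b) 0 \<longleftrightarrow> eval a 0 \<and> eval b 0"
  by (simp_all add: eval_iffs(3,5))

lemmas truth_simps = lifts_0 sub_numl eval_iffs(1,2) no_eval eval_numl eval_isN_iff
  eval_Eq_1_iff eval_Eq_0_iff eval_connective_iffs

lemma step_sub_head_step: "c \<triangleright> c' \<Longrightarrow> step (sub \<sigma> c) (sub \<sigma> c')"
  by (blast intro: step_eval_sub head_step_is_step)

lemma not_true_and_false: "eval a 0 \<Longrightarrow> \<not> eval a 1"
  using eval_deterministic[of a 0 1] by auto

text \<open>
  The rules for the connectives and for equality only combine the truth conditions. Rules with a
  premise \<open>isN a\<close> replace \<open>a\<close> by the numeral of its value: induction then is induction on that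
  value, and quantifier elimination is an instance of the infinitary evaluation rule.
\<close>

lemma follows_sound:
  assumes "follows P (\<Gamma>, c)" and "models \<sigma> \<Gamma>"
    and truth: "\<And>\<Gamma> c \<sigma>. (\<Gamma>, c) \<in> P \<Longrightarrow> models \<sigma> \<Gamma> \<Longrightarrow> eval (sub \<sigma> c) 1"
  shows "eval (sub \<sigma> c) 1"
  using assms(1,2)
proof cases
  case (subst_rule \<Delta> d s v)
  have "models (\<sigma>(v := sub \<sigma> s)) \<Delta>"
    using assms(2) unfolding subst_rule(1) models_subst_var .
  with subst_rule(3) show ?thesis
    unfolding subst_rule(2) sub_subst_var by (rule truth)
next
  case (eq_subst a b v p)
  then have "eval (sub \<sigma> (Eq a b)) 1" "eval (sub \<sigma> (subst_var v a p)) 1"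
    using truth assms(2) by blast+
  then show ?thesis
    unfolding eq_subst(1) by (auto simp: truth_simps sub_subst_var intro: eval_sub_upd)
next
  case (ind_rule i c a)
  then have base: "eval (sub \<sigma> (subst_var i Zero c)) 1" and "eval (sub \<sigma> (isN a)) 1"
    using truth assms(2) by blast+
  then obtain n where n: "eval (sub \<sigma> a) n" by (auto simp: truth_simps)
  (* The object-level induction is only run through the numerals; a itself is reached at the end,
     by replacing the numeral of its value. *)
  have "eval (sub (\<sigma>(i := numl k)) c) 1" for k
  proof (induction k)
    case 0
    then show ?case using base by (simp add: sub_subst_var lifts_0 del: fun_upd_apply)
  next
    case (Suc k)
    have "models (\<sigma>(i := numl k)) (finsert (isN (Var i)) (finsert c \<Gamma>))"
      using Suc.IH assms(2)
      by (simp add: models_finsert models_fun_upd[OF ind_rule(6)] truth_simps fun_upd_same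
          del: fun_upd_apply)
    then have "eval (sub (\<sigma>(i := numl k)) (subst_var i (Succ (Var i)) c)) 1"
      using ind_rule truth by blast
    then show ?case by (simp add: sub_subst_var lifts_0 fun_upd_same del: fun_upd_apply)
  qed
  moreover have "eval (numl n) n" by (simp add: eval_numl)
  ultimately show ?thesis unfolding ind_rule(1) sub_subst_var
    using n by (blast intro: eval_sub_upd)
next
  case (recursor m h g)
  let ?g = "sub \<sigma> g" and ?h = "sub \<sigma> h" and ?m = "sub \<sigma> m"
  have "eval (sub \<sigma> (isN m)) 1" "eval (sub \<sigma> (isN (h \<cdot> m \<cdot> (Rec \<cdot> g \<cdot> h \<cdot> m)))) 1"
    using recursor truth assms(2) by blast+
  then obtain k n where k: "eval ?m k" and n: "eval (?h \<cdot> ?m \<cdot> (Rec \<cdot> ?g \<cdot> ?h \<cdot> ?m)) n"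
    by (auto simp: truth_simps)
  have "?m \<approx> numl k" using k by (auto simp: eval_numl intro: same_value)
  then have "?h \<cdot> ?m \<cdot> (Rec \<cdot> ?g \<cdot> ?h \<cdot> ?m) \<approx> ?h \<cdot> numl k \<cdot> (Rec \<cdot> ?g \<cdot> ?h \<cdot> numl k)"
    by (intro similar_App similar_refl)
  with n have "eval (?h \<cdot> numl k \<cdot> (Rec \<cdot> ?g \<cdot> ?h \<cdot> numl k)) n"
    by (rule eval_similar)
  then have "eval (Rec \<cdot> ?g \<cdot> ?h \<cdot> Succ ?m) n"
    by (rule eval_step[OF step_rec_S[OF eval_succ[OF k]]])
  then show ?thesis
    unfolding recursor(1) using n by (auto simp: lifts_0 eval_Eq_1_iff)
next
  case (all_I f)
  have "eval (sub \<sigma> f \<cdot> numl n) 1" for n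
  proof -
    have "eval (sub (case_nat (numl n) \<sigma>) (up f \<cdot> Var 0)) 1"
      using assms(2) by (intro truth[OF all_I(2)])
        (simp add: models_finsert models_up truth_simps)
    then show ?thesis by (simp add: lifts_0 sub_up)
  qed
  then show ?thesis unfolding all_I(1) by (simp add: lifts_0 eval_iffs(6))
next
  case (all_E f a)
  then have "eval (sub \<sigma> (AllC \<cdot> f)) 1" "eval (sub \<sigma> (isN a)) 1"
    using truth assms(2) by blast+
  then obtain n where "eval (sub \<sigma> f \<cdot> numl n) 1" "eval (sub \<sigma> a) n"
    by (auto simp: lifts_0 eval_iffs(6) eval_isN_iff)
  then show ?thesis
    unfolding all_E(1) using eval_App_arg[of "numl n" n] by (simp add: lifts_0 eval_numl)
next
  case (not_all_I f a)
  then have "eval (sub \<sigma> (Neg (f \<cdot> a))) 1" "eval (sub \<sigma> (isN a)) 1"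
    using truth assms(2) by blast+
  then obtain n where "eval (sub \<sigma> f \<cdot> sub \<sigma> a) 0" "eval (sub \<sigma> a) n"
    by (auto simp: truth_simps)
  then have "eval (sub \<sigma> f \<cdot> numl n) 0"
    using eval_App_arg[of "sub \<sigma> a" n "numl n"] by (simp add: eval_numl)
  then have "eval (AllC \<cdot> sub \<sigma> f) 0" by (rule eval_not_all)
  then show ?thesis unfolding not_all_I(1) by (simp add: truth_simps)
next
  case (not_all_E f)
  then have "eval (sub \<sigma> (Neg (AllC \<cdot> f))) 1"
    using truth assms(2) by blast
  then obtain n where n: "eval (sub \<sigma> f \<cdot> numl n) 0"
    by (auto simp: truth_simps eval_iffs(6))
  have "eval (sub (case_nat (numl n) \<sigma>) (up c)) 1"
    using n assms(2) by (intro truth[OF not_all_E(2)])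
      (simp add: models_finsert models_up truth_simps sub_up)
  then show ?thesis by (simp only: sub_up)
next
  case (conv_I c')
  then have "eval (sub \<sigma> c') 1" using truth assms(2) by blast
  then show ?thesis by (simp only: eval_along_step[OF step_sub_head_step[OF conv_I(1)]])
next
  case (conv_E c')
  then have "eval (sub \<sigma> c') 1" using truth assms(2) by blast
  then show ?thesis by (simp only: eval_along_step[OF step_sub_head_step[OF conv_E(1)]])
next
  case (conv_eq c c')
  then have "eval (sub \<sigma> (isN c')) 1" using truth assms(2) by blast
  then show ?thesis unfolding conv_eq(1)
    by (auto simp: truth_simps eval_along_step[OF step_sub_head_step[OF conv_eq(2)]])
next
  case (succ_neq_zero a)
  then have "eval (sub \<sigma> (isN a)) 1" using truth assms(2) by blast
  then obtain n where "eval (sub \<sigma> a) n" by (auto simp: truth_simps)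
  then have "eval (Eq (Succ (sub \<sigma> a)) Zero) 0"
    by (intro eval_neq[of _ "Suc n" _ 0] eval_succ eval_zero) auto
  then show ?thesis unfolding succ_neq_zero(1) by (simp add: lifts_0 eval_connective_iffs)
next
  case (succ_neq_I a b)
  then have "eval (sub \<sigma> (Neq a b)) 1" using truth assms(2) by blast
  then obtain n m where "eval (sub \<sigma> a) n" "eval (sub \<sigma> b) m" "n \<noteq> m"
    by (auto simp: truth_simps)
  then have "eval (Eq (Succ (sub \<sigma> a)) (Succ (sub \<sigma> b))) 0"
    by (intro eval_neq[of _ "Suc n" _ "Suc m"] eval_succ) auto
  then show ?thesis unfolding succ_neq_I(1) by (simp add: lifts_0 eval_connective_iffs)
qed (use assms(2) in
  \<open>fastforce simp: truth_simps models_finsert dest: truth not_true_and_false\<close>)+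

lemma derivable_sound:
  assumes "\<Gamma> \<turnstile> c" "models \<sigma> \<Gamma>"
  shows "eval (sub \<sigma> c) 1"
proof -
  obtain js where js: "is_proof js" "(\<Gamma>, c) \<in> set js"
    using assms(1) by (auto simp: derivable_def)
  have "eval (sub \<sigma> c) 1" if "n < length js" "js ! n = (\<Gamma>, c)" "models \<sigma> \<Gamma>" for n \<Gamma> c \<sigma>
    using that
  proof (induction n arbitrary: \<Gamma> c \<sigma> rule: less_induct)
    case (less n)
    have "follows (set (take n js)) (\<Gamma>, c)"
      using js(1) less.prems by (auto simp: is_proof_def)
    then show ?case
      using \<open>models \<sigma> \<Gamma>\<close>
    proof (rule follows_sound)
      fix \<Delta> d \<tau> assume "(\<Delta>, d) \<in> set (take n js)" and \<tau>: "models \<tau> \<Delta>"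
      then obtain m where "m < n" "js ! m = (\<Delta>, d)"
        using less.prems by (auto simp: in_set_conv_nth)
      then show "eval (sub \<tau> d) 1" using less.IH[of m \<Delta> d \<tau>] less.prems \<tau> by simp
    qed
  qed
  then show ?thesis using js(2) assms(2) by (metis in_set_conv_nth)
qed

theorem theorem4p4: "\<not> (\<exists>c. {||} \<turnstile> c \<and> {||} \<turnstile> Neg c)"
proof
  assume "\<exists>c. {||} \<turnstile> c \<and> {||} \<turnstile> Neg c"
  then obtain c where c: "{||} \<turnstile> c" "{||} \<turnstile> Neg c" by blast
  have "models Var {||}" by (simp add: models_def)
  with c have "eval c 1" "eval (Neg c) 1"
    using derivable_sound[of "{||}" _ Var] unfolding sub_Var by blast+
  then show False
    using not_true_and_false eval_connective_iffs(1) by blast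
qed

end
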